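(* Let $\mathbb{K}$ be a field of characteristic $0$, let $S=\mathbb{K}[x_1,\dots,x_l]$ with the standard grading, and let $I$ be an almost revlex ideal of $S$. Then $(S/I,x_l,x_{l-1},\dots,x_1)$ has the $l$-SLP.
   Context: A monomial ideal $I$ of $S$ is an almost revlex ideal if for any power-product $t$ in the minimal generating set of $I$, every power-product $t'$ of $S$ with $\deg(t')=\deg(t)$ and $t'>_{\mathrm{DegRevLex}}t$ belongs to $I$; DegRevLex is the degree reverse lexicographic order with $x_1>x_2>\dots>x_l$. A linear map is full-rank if it is injective or surjective. A graded ring $R=\bigoplus_{i\ge0}R_i$ over $\mathbb{K}$ with $\dim_{\mathbb{K}}R_i<\infty$ (not necessarily Artinian) has the SLP with Lefschetz element $\ell\in R_1$ if $\times\ell^s\colon R_i\to R_{i+s}$ is full-rank for all $i\ge 0$, $s\ge1$. For $k\ge1$, $(R,\ell_1,\dots,\ell_k)$ with $\ell_i\in R_1$ has the $k$-SLP if $R$ has the SLP with Lefschetz element $\ell_1$ and, for all $i=2,\dots,k$, $R/\langle\ell_1,\dots,\ell_{i-1}\rangle$ has the SLP with Lefschetz element (the class of) $\ell_i$. *)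

theory Defs
  imports
    "HOL-Algebra.QuotRing"
    "HOL-Algebra.Module"
    "HOL-Decision_Procs.Algebra_Aux"
    "HOL-Library.Poly_Mapping"
begin

section \<open>Graded algebras and the strong Lefschetz property\<close>

record ('k, 'a) graded_ring = "('k, 'a) module" +
  component :: "nat \<Rightarrow> 'a set"

text \<open>
  A commutative graded ring \<open>A = A\<^sub>0 \<oplus> A\<^sub>1 \<oplus> \<dots>\<close> over a field \<open>K\<close>, all of whose components are
  finite-dimensional over \<open>K\<close>. The zero ring is not excluded.
\<close>

locale graded_algebra = algebra K A
  for K :: "('k, 'm) ring_scheme" and A :: "('k, 'a) graded_ring" +
  assumes base_field: "field K"
    and component_submodule: "\<And>i. submodule (component A i) K A"
    and component_mult: "\<And>i j a b. \<lbrakk>a \<in> component A i; b \<in> component A j\<rbrakk> \<Longrightarrow>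
      a \<otimes>\<^bsub>A\<^esub> b \<in> component A (i + j)"
    and direct_sum: "\<And>a. a \<in> carrier A \<Longrightarrow>
      \<exists>!f. (\<forall>i. f i \<in> component A i) \<and> finite {i. f i \<noteq> \<zero>\<^bsub>A\<^esub>} \<and>
           a = (\<Oplus>\<^bsub>A\<^esub>i\<in>{i. f i \<noteq> \<zero>\<^bsub>A\<^esub>}. f i)"
    and component_finite_dim: "\<And>i. \<exists>B. finite B \<and> B \<subseteq> component A i \<and>
      (\<forall>a\<in>component A i. \<exists>c\<in>B \<rightarrow> carrier K. a = (\<Oplus>\<^bsub>A\<^esub>b\<in>B. c b \<odot>\<^bsub>A\<^esub> b))"

text \<open>
  The quotient by an ideal \<open>J\<close>, with the induced scalar multiplication and with the images of the
  components as components (this is a grading when \<open>J\<close> is homogeneous). The scalar multiplication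
  is written in the style of \<^const>\<open>rcoset_mult\<close>: on cosets it is \<open>c \<odot> (J + x) = J + c \<odot> x\<close>.
\<close>

definition graded_quot :: "('k, 'a) graded_ring \<Rightarrow> 'a set \<Rightarrow> ('k, 'a set) graded_ring" where
  "graded_quot A J =
    \<lparr>carrier = carrier (A Quot J), mult = mult (A Quot J), one = one (A Quot J),
     zero = zero (A Quot J), add = add (A Quot J),
     smult = (\<lambda>c X. \<Union>x\<in>X. J +>\<^bsub>A\<^esub> (c \<odot>\<^bsub>A\<^esub> x)),
     component = (\<lambda>i. (\<lambda>a. J +>\<^bsub>A\<^esub> a) ` component A i)\<rparr>"

definition full_rank :: "('a \<Rightarrow> 'b) \<Rightarrow> 'a set \<Rightarrow> 'b set \<Rightarrow> bool" where
  "full_rank f V W \<longleftrightarrow> inj_on f V \<or> f ` V = W"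

definition has_slp :: "('k, 'm) ring_scheme \<Rightarrow> ('k, 'a) graded_ring \<Rightarrow> 'a \<Rightarrow> bool" where
  "has_slp K A u \<longleftrightarrow>
     graded_algebra K A \<and> u \<in> component A 1 \<and>
     (\<forall>i. \<forall>s\<ge>1. full_rank (\<lambda>a. (u [^]\<^bsub>A\<^esub> (s::nat)) \<otimes>\<^bsub>A\<^esub> a) (component A i) (component A (i + s)))"

text \<open>\<open>has_k_slp K k A u\<close>: the tuple \<open>(A, u 1, \<dots>, u k)\<close> has the \<open>k\<close>-SLP.\<close>

definition has_k_slp ::
  "('k, 'm) ring_scheme \<Rightarrow> nat \<Rightarrow> ('k, 'a) graded_ring \<Rightarrow> (nat \<Rightarrow> 'a) \<Rightarrow> bool" where
  "has_k_slp K k A u \<longleftrightarrow>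
     1 \<le> k \<and> (\<forall>i\<in>{1..k}. u i \<in> component A 1) \<and>
     has_slp K A (u 1) \<and>
     (\<forall>i\<in>{2..k}. let J = Idl\<^bsub>A\<^esub> (u ` {1..i - 1}) in has_slp K (graded_quot A J) (J +>\<^bsub>A\<^esub> u i))"


section \<open>Polynomials in \<open>x\<^sub>1, \<dots>, x\<^sub>l\<close>\<close>

text \<open>
  A power-product is its exponent vector, indexed by the variables \<open>1, \<dots>, l\<close>; a polynomial is a
  finitely supported map from power-products to coefficients.
\<close>

type_synonym power_product = "nat \<Rightarrow>\<^sub>0 nat"
type_synonym 'k polynomial = "power_product \<Rightarrow>\<^sub>0 'k"

definition power_products :: "nat \<Rightarrow> power_product set" where
  "power_products l = {t. Poly_Mapping.keys t \<subseteq> {1..l}}"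

definition pp_deg :: "power_product \<Rightarrow> nat" where
  "pp_deg t = (\<Sum>i\<in>Poly_Mapping.keys t. Poly_Mapping.lookup t i)"

definition pp_poly :: "power_product \<Rightarrow> 'k::field polynomial" where
  "pp_poly t = Poly_Mapping.single t 1"

definition var :: "nat \<Rightarrow> 'k::field polynomial" where
  "var i = pp_poly (Poly_Mapping.single i 1)"

definition poly_ring :: "nat \<Rightarrow> ('k::field, 'k polynomial) graded_ring" where
  "poly_ring l =
    \<lparr>carrier = {p. Poly_Mapping.keys p \<subseteq> power_products l}, mult = (*), one = 1,
     zero = 0, add = (+),
     smult = (\<lambda>c p. Poly_Mapping.single 0 c * p),
     component = (\<lambda>d. {p. Poly_Mapping.keys p \<subseteq> {t \<in> power_products l. pp_deg t = d}})\<rparr>"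


section \<open>Almost revlex ideals\<close>

text \<open>
  \<open>degrevlex_less t t'\<close> means \<open>t' > t\<close> in the degree reverse lexicographic order with
  \<open>x\<^sub>1 > x\<^sub>2 > \<dots>\<close>: at equal degree, \<open>t'\<close> has the smaller exponent at the last variable where the
  exponents differ.
\<close>

definition degrevlex_less :: "power_product \<Rightarrow> power_product \<Rightarrow> bool" where
  "degrevlex_less t t' \<longleftrightarrow>
     pp_deg t < pp_deg t' \<or>
     pp_deg t = pp_deg t' \<and>
       (\<exists>i. Poly_Mapping.lookup t' i < Poly_Mapping.lookup t i \<and>
            (\<forall>j>i. Poly_Mapping.lookup t' j = Poly_Mapping.lookup t j))"

definition pp_generating_set :: "nat \<Rightarrow> 'k::field polynomial set \<Rightarrow> power_product set \<Rightarrow> bool" where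
  "pp_generating_set l I G \<longleftrightarrow> G \<subseteq> power_products l \<and> I = Idl\<^bsub>poly_ring l\<^esub> (pp_poly ` G)"

definition monomial_ideal :: "nat \<Rightarrow> 'k::field polynomial set \<Rightarrow> bool" where
  "monomial_ideal l I \<longleftrightarrow> ideal I (poly_ring l) \<and> (\<exists>G. pp_generating_set l I G)"

definition minimal_pp_generating_set ::
  "nat \<Rightarrow> 'k::field polynomial set \<Rightarrow> power_product set \<Rightarrow> bool" where
  "minimal_pp_generating_set l I G \<longleftrightarrow>
     pp_generating_set l I G \<and> (\<forall>H. H \<subset> G \<longrightarrow> \<not> pp_generating_set l I H)"

text \<open>
  A monomial ideal has exactly one minimal generating set of power-products, so the existential
  quantifier below merely names it.
\<close>

definition almost_revlex_ideal :: "nat \<Rightarrow> 'k::field polynomial set \<Rightarrow> bool" where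
  "almost_revlex_ideal l I \<longleftrightarrow>
     monomial_ideal l I \<and>
     (\<exists>G. minimal_pp_generating_set l I G \<and>
       (\<forall>t\<in>G. \<forall>t'\<in>power_products l.
          pp_deg t' = pp_deg t \<and> degrevlex_less t t' \<longrightarrow> pp_poly t' \<in> I))"

end

theory Submission
  imports Defs
begin

text \<open>
  Multiplication by \<open>x\<^sub>j\<^sup>s\<close> maps power-products injectively to power-products, so in a quotient by a
  monomial ideal it is full-rank in a given degree as soon as either no standard power-product is killed, or every standard
  power-product of the target degree is divisible by \<open>x\<^sub>j\<^sup>s\<close>. Suppose \<open>t\<close> of
  degree \<open>d\<close> is killed by \<open>x\<^sub>j\<^sup>s\<close>. Then some minimal generator \<open>g\<close> divides \<open>x\<^sub>j\<^sup>s t\<close> and has a larger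
  exponent of \<open>x\<^sub>j\<close> than \<open>t\<close>. A power-product of degree \<open>d + s\<close> not divisible by \<open>x\<^sub>j\<^sup>s\<close> then has a
  divisor of degree \<open>deg g\<close> with a smaller exponent of \<open>x\<^sub>j\<close> than \<open>g\<close>; once the variables after \<open>x\<^sub>j\<close> are
  factored out, this divisor is revlex-larger than \<open>g\<close>, hence lies in the ideal.
\<close>

abbreviation keys :: "('a \<Rightarrow>\<^sub>0 'b::zero) \<Rightarrow> 'a set" where "keys \<equiv> Poly_Mapping.keys"
abbreviation lookup :: "('a \<Rightarrow>\<^sub>0 'b::zero) \<Rightarrow> 'a \<Rightarrow> 'b" where "lookup \<equiv> Poly_Mapping.lookup"

subsection \<open>Power-products\<close>

lemma pp_deg_eq_sum:
  assumes "finite A" "keys t \<subseteq> A"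
  shows "pp_deg t = (\<Sum>i\<in>A. lookup t i)"
  unfolding pp_deg_def using assms by (intro sum.mono_neutral_left) (auto simp: in_keys_iff)

lemma pp_deg_zero [simp]: "pp_deg 0 = 0"
  by (simp add: pp_deg_def)

lemma pp_deg_add [simp]: "pp_deg (s + t) = pp_deg s + pp_deg t"
proof -
  let ?A = "keys s \<union> keys t"
  have "keys (s + t) \<subseteq> ?A" by (rule Poly_Mapping.keys_add)
  then show ?thesis
    by (simp add: pp_deg_eq_sum[of ?A] lookup_add sum.distrib)
qed

lemma pp_deg_single [simp]: "pp_deg (Poly_Mapping.single i n) = n"
  by (subst pp_deg_eq_sum[of "{i}"]) auto

lemma keys_pp_add: "keys (s + t :: power_product) = keys s \<union> keys t"
  by (auto simp: in_keys_iff lookup_add)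

lemma power_products_add_iff [simp]:
  "s + t \<in> power_products l \<longleftrightarrow> s \<in> power_products l \<and> t \<in> power_products l"
  by (auto simp: power_products_def keys_pp_add)

lemma power_products_zero [simp]: "0 \<in> power_products l"
  by (simp add: power_products_def)

lemma power_products_single [simp]:
  "Poly_Mapping.single i n \<in> power_products l \<longleftrightarrow> n = 0 \<or> i \<in> {1..l}"
  by (simp add: power_products_def)

lemma pp_split_variable:
  fixes t :: power_product
  assumes "n \<le> lookup t i"
  obtains t' where "t = Poly_Mapping.single i n + t'" "lookup t' i = lookup t i - n"
    "\<And>k. k \<noteq> i \<Longrightarrow> lookup t' k = lookup t k"
proof
  show "t = Poly_Mapping.single i n + (t - Poly_Mapping.single i n)"
    using assms by (intro poly_mapping_eqI) (auto simp: lookup_add lookup_minus lookup_single when_def)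
qed (auto simp: lookup_minus lookup_single)

lemma pp_split_off_variable:
  fixes t :: power_product
  obtains t' where "t = Poly_Mapping.single i (lookup t i) + t'" "lookup t' i = 0"
    "\<And>k. k \<noteq> i \<Longrightarrow> lookup t' k = lookup t k"
proof -
  obtain t' where t': "t = Poly_Mapping.single i (lookup t i) + t'"
    "lookup t' i = lookup t i - lookup t i" "\<And>k. k \<noteq> i \<Longrightarrow> lookup t' k = lookup t k"
    using pp_split_variable[of "lookup t i" t i, OF order_refl] by blast
  from t'(2) have "lookup t' i = 0" by (simp only: diff_self_eq_0)
  with t'(1) show thesis using t'(3) by (rule that)
qed

lemma pp_divisor_of_degree:
  assumes "n \<le> pp_deg t"
  obtains s r where "t = s + r" "pp_deg s = n"
  using assms
proof (induction n arbitrary: thesis)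
  case 0
  then show ?case by (metis add_0 pp_deg_zero)
next
  case (Suc n)
  then obtain s r where sr: "t = s + r" "pp_deg s = n" by (metis Suc_leD)
  with Suc.prems have "r \<noteq> 0" by auto
  then obtain i where "1 \<le> lookup r i"
    by (metis in_keys_iff keys_eq_empty all_not_in_conv less_one not_le)
  then obtain r' where "r = Poly_Mapping.single i 1 + r'" by (rule pp_split_variable)
  then show ?case using Suc.prems(1)[of "s + Poly_Mapping.single i 1" r'] sr
    by (simp add: add.assoc)
qed

lemma finite_pp_degree: "finite {t \<in> power_products l. pp_deg t = d}"
proof (rule finite_subset)
  let ?F = "{f. \<forall>i. (i \<in> {1..l} \<longrightarrow> f i \<in> {..d}) \<and> (i \<notin> {1..l} \<longrightarrow> f i = (0::nat))}"
  show "{t \<in> power_products l. pp_deg t = d} \<subseteq> lookup -` ?F"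
  proof clarsimp
    fix t i assume t: "t \<in> power_products l"
    have "lookup t i \<le> pp_deg t"
      unfolding pp_deg_def by (cases "i \<in> keys t") (auto intro: member_le_sum simp: in_keys_iff)
    with t show "(Suc 0 \<le> i \<and> i \<le> l \<longrightarrow> lookup t i \<le> pp_deg t) \<and>
        ((Suc 0 \<le> i \<longrightarrow> \<not> i \<le> l) \<longrightarrow> lookup t i = 0)"
      by (auto simp: power_products_def subset_iff in_keys_iff)
  qed
  have "finite ?F" by (rule finite_set_of_finite_funs) auto
  then show "finite (lookup -` ?F)"
    by (rule finite_vimageI) (rule injI, simp add: Poly_Mapping.lookup_inject)
qed

text \<open>The exponents of the monomial ideal generated by \<open>G\<close>. The cofactor
  \<open>s\<close> needs no side condition: \<open>g + s\<close> lies in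
  \<open>power_products l\<close> only if both summands do.\<close>

definition pp_multiples :: "nat \<Rightarrow> power_product set \<Rightarrow> power_product set" where
  "pp_multiples l G = {t \<in> power_products l. \<exists>g\<in>G. \<exists>s. t = g + s}"

lemma pp_multiples_Un: "pp_multiples l (G \<union> H) = pp_multiples l G \<union> pp_multiples l H"
  by (auto simp: pp_multiples_def)

lemma pp_multiples_add:
  "t \<in> pp_multiples l G \<Longrightarrow> s \<in> power_products l \<Longrightarrow> s + t \<in> pp_multiples l G"
  unfolding pp_multiples_def by (force simp: add.left_commute)

lemma pp_multiples_variables:
  "t \<in> pp_multiples l ((\<lambda>k. Poly_Mapping.single k 1) ` V) \<longleftrightarrow>
     t \<in> power_products l \<and> (\<exists>k\<in>V. lookup t k \<noteq> 0)"
proof -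
  have "(\<exists>s. t = Poly_Mapping.single k 1 + s) \<longleftrightarrow> lookup t k \<noteq> 0" for k
    using pp_split_variable[of 1 t k] by (fastforce simp: lookup_add)
  then show ?thesis by (auto simp: pp_multiples_def)
qed

subsection \<open>Almost revlex sets of power-products\<close>

text \<open>Build the divisor greedily from the part \<open>m'\<close> of \<open>m\<close> free of
  \<open>x_j\<close>, and take powers of \<open>x_j\<close> only when \<open>m'\<close> is
  exhausted. In that case exactly \<open>D - pp_deg m' = D + lookup m j - pp_deg m\<close> factors
  \<open>x_j\<close> are used, fewer than \<open>a\<close> by the second assumption. If
  \<open>m'\<close> suffices, the exponent is 0 and \<open>0 < a\<close> gives the bound.\<close>

lemma divisor_with_small_exponent:
  assumes "D \<le> pp_deg m" "D + lookup m j < pp_deg m + a" "0 < a"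
  obtains w r where "m = w + r" "pp_deg w = D" "lookup w j < a"
proof -
  let ?c = "lookup m j"
  obtain m' where m': "m = Poly_Mapping.single j ?c + m'" "lookup m' j = 0"
    using pp_split_off_variable[of m j] by blast
  have deg: "pp_deg m = ?c + pp_deg m'" by (subst m'(1)) simp
  show thesis
  proof (cases "D \<le> pp_deg m'")
    case True
    then obtain w r where wr: "m' = w + r" "pp_deg w = D" by (rule pp_divisor_of_degree)
    with m'(2) have "lookup w j = 0" by (simp add: lookup_add)
    moreover have "m = w + (Poly_Mapping.single j ?c + r)"
      by (subst m'(1), subst wr(1)) (simp only: ac_simps)
    ultimately show thesis using wr(2) \<open>0 < a\<close> by (intro that) auto
  next
    case False
    let ?e = "D - pp_deg m'"
    have "?e \<le> ?c" using assms deg by linarith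
    then have "Poly_Mapping.single j ?c =
        Poly_Mapping.single j ?e + Poly_Mapping.single j (?c - ?e)"
      by (simp flip: single_add)
    then have eq: "m = (m' + Poly_Mapping.single j ?e) + Poly_Mapping.single j (?c - ?e)"
      by (subst m'(1)) (simp only: ac_simps)
    have "pp_deg (m' + Poly_Mapping.single j ?e) = D" using False by simp
    moreover have "lookup (m' + Poly_Mapping.single j ?e) j < a"
      using False m'(2) assms deg by (simp add: lookup_add)
    ultimately show thesis by (rule that[OF eq])
  qed
qed

text \<open>\<open>M\<close> consists of the power-products of the ideal generated by
  \<open>G\<close> and \<open>x_{j+1}, ..., x_l\<close>, so one statement covers every stage of the
  \<open>l\<close>-SLP; \<open>j = l\<close> is the stage without added variables. The first
  alternative will give injectivity and the second surjectivity of multiplication by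
  \<open>x_j^s\<close> in degree \<open>d\<close>.\<close>

lemma revlex_multiplication_dichotomy:
  assumes G: "G \<subseteq> power_products l"
    and revlex: "\<And>g w. g \<in> G \<Longrightarrow> w \<in> power_products l \<Longrightarrow> pp_deg w = pp_deg g \<Longrightarrow>
      degrevlex_less g w \<Longrightarrow> w \<in> pp_multiples l G"
    and M: "M = pp_multiples l (G \<union> (\<lambda>k. Poly_Mapping.single k 1) ` {j<..l})"
    and j: "j \<in> {1..l}"
  shows "(\<forall>t\<in>power_products l. pp_deg t = d \<and> t \<notin> M \<longrightarrow> Poly_Mapping.single j s + t \<notin> M) \<or>
    (\<forall>m\<in>power_products l. pp_deg m = d + s \<and> m \<notin> M \<longrightarrow> s \<le> lookup m j)"
proof (rule ccontr)
  assume "\<not> ?thesis"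
  then obtain t m where t: "t \<in> power_products l" "pp_deg t = d" "t \<notin> M"
      "Poly_Mapping.single j s + t \<in> M"
    and m: "m \<in> power_products l" "pp_deg m = d + s" "m \<notin> M" "lookup m j < s"
    by (auto simp: not_le)
  have M_iff: "u \<in> M \<longleftrightarrow> u \<in> pp_multiples l G \<or>
      u \<in> power_products l \<and> (\<exists>k\<in>{j<..l}. lookup u k \<noteq> 0)" for u
    unfolding M pp_multiples_Un by (simp only: Un_iff pp_multiples_variables)
  \<comment> \<open>Outside \<open>M\<close> no variable after \<open>x_j\<close> occurs: those up
    to \<open>x_l\<close> generate elements of \<open>M\<close>, and there are none beyond
    \<open>x_l\<close>.\<close>
  have high: "lookup u k = 0" if "u \<in> power_products l" "u \<notin> M" "k > j" for u k
    using that by (cases "k \<le> l") (auto simp: M_iff power_products_def subset_iff in_keys_iff)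
  \<comment> \<open>Multiplying by \<open>x_j^s\<close> introduces no variable after
    \<open>x_j\<close>, so membership in \<open>M\<close> must come from \<open>G\<close>.\<close>
  have "Poly_Mapping.single j s + t \<in> pp_multiples l G"
    using t high[OF t(1,3)] by (fastforce simp: M_iff lookup_add lookup_single)
  then obtain g r where g: "g \<in> G" "Poly_Mapping.single j s + t = g + r"
    by (auto simp: pp_multiples_def)
  define a where "a = lookup g j"
  have lg: "lookup g k + lookup r k = lookup t k + (s when j = k)" for k
    using arg_cong[OF g(2), of "\<lambda>u. lookup u k"] by (simp add: lookup_add lookup_single)
  have g_high: "lookup g k = 0" if "k > j" for k
    using lg[of k] high[OF t(1,3) that] that by simp
  obtain g' where g': "g = Poly_Mapping.single j a + g'"
      "lookup g' j = 0" "\<And>k. k \<noteq> j \<Longrightarrow> lookup g' k = lookup g k"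
    unfolding a_def using pp_split_off_variable[of g j] by blast
  obtain t' where t': "t = Poly_Mapping.single j (lookup t j) + t'"
      "lookup t' j = 0" "\<And>k. k \<noteq> j \<Longrightarrow> lookup t' k = lookup t k"
    using pp_split_off_variable[of t j] by blast
  \<comment> \<open>Away from \<open>x_j\<close>, the divisor \<open>g\<close> of
    \<open>x_j^s t\<close> can only draw on \<open>t\<close>; hence \<open>g'\<close> divides
    \<open>t'\<close>.\<close>
  have le: "lookup g' k \<le> lookup t' k" for k
    
  proof (cases "k = j")
    case False
    then show ?thesis using lg[of k] g'(3)[OF False] t'(3)[OF False] by (simp add: when_def)
  qed (simp add: g'(2))
  have t'g': "t' = g' + (t' - g')"
    by (intro poly_mapping_eqI) (simp add: lookup_add lookup_minus le)
  \<comment> \<open>Otherwise \<open>g = x_j^a g'\<close> would divide \<open>t\<close> itself,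
    contrary to \<open>t\<close> lying outside \<open>M\<close>.\<close>
  have a: "lookup t j < a"
  proof (rule ccontr)
    assume "\<not> ?thesis"
    then have "Poly_Mapping.single j (lookup t j) =
        Poly_Mapping.single j a + Poly_Mapping.single j (lookup t j - a)"
      by (simp flip: single_add)
    then have "t = (Poly_Mapping.single j a + Poly_Mapping.single j (lookup t j - a)) +
        (g' + (t' - g'))"
      by (subst t'(1), subst t'g') (simp only:)
    also have "\<dots> = g + (Poly_Mapping.single j (lookup t j - a) + (t' - g'))"
      by (subst g'(1)) (simp only: ac_simps)
    finally have "t = g + (Poly_Mapping.single j (lookup t j - a) + (t' - g'))" .
    with g(1) t(1) have "t \<in> pp_multiples l G" unfolding pp_multiples_def by blast
    with t(3) show False by (simp add: M_iff)
  qed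
  have "a \<le> lookup t j + s" using lg[of j] unfolding a_def by simp
  have dg: "pp_deg g = a + pp_deg g'" by (subst g'(1)) simp
  have dt: "d = lookup t j + pp_deg t'" using t(2) by (subst (asm) t'(1)) simp
  have dle: "pp_deg g' \<le> pp_deg t'" by (subst t'g') simp
  \<comment> \<open>Both numerical conditions compare \<open>m\<close> with \<open>x_j^s t\<close>,
    which has the same degree \<open>d + s\<close>: \<open>g\<close> divides \<open>x_j^s t\<close>,
    and \<open>pp_deg g' + lookup m j < pp_deg t' + s\<close> because
    \<open>lookup m j < s\<close>.\<close>
  obtain w r where w: "m = w + r" "pp_deg w = pp_deg g" "lookup w j < a"
  proof (rule divisor_with_small_exponent[of "pp_deg g" m j a])
    show "pp_deg g \<le> pp_deg m" "pp_deg g + lookup m j < pp_deg m + a" "0 < a"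
      using m(2,4) dg dt dle a \<open>a \<le> lookup t j + s\<close> by auto
  qed
  have "lookup w k = 0" if "k > j" for k
    using high[OF m(1,3) that] w(1) by (simp add: lookup_add)
  \<comment> \<open>The degrees agree and all exponents after \<open>j\<close> vanish in both, so
    the comparison is decided at \<open>x_j\<close>.\<close>
  then have "degrevlex_less g w"
    unfolding degrevlex_less_def using w(2,3) g_high a_def by auto
  moreover have wr: "w \<in> power_products l" "r \<in> power_products l" using m(1) w(1) by auto
  ultimately have "w \<in> pp_multiples l G" using revlex g(1) w(2) by blast
  from pp_multiples_add[OF this wr(2)] have "m \<in> M" by (simp add: M_iff w(1) add.commute)
  with m(3) show False by blast
qed

subsection \<open>Polynomials\<close>

lemma poly_ring_simps [simp]:
  "carrier (poly_ring l) = {p. keys p \<subseteq> power_products l}"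
  "p \<otimes>\<^bsub>poly_ring l\<^esub> q = p * q" "\<one>\<^bsub>poly_ring l\<^esub> = 1"
  "\<zero>\<^bsub>poly_ring l\<^esub> = 0" "p \<oplus>\<^bsub>poly_ring l\<^esub> q = p + q"
  "c \<odot>\<^bsub>poly_ring l\<^esub> p = Poly_Mapping.single 0 c * p"
  "component (poly_ring l) d = {p. keys p \<subseteq> {t \<in> power_products l. pp_deg t = d}}"
  by (auto simp: poly_ring_def)

section \<open>Supports and coefficients of sums and products\<close>

lemma keys_add_subset: "keys p \<subseteq> A \<Longrightarrow> keys q \<subseteq> A \<Longrightarrow> keys (p + q) \<subseteq> A"
  using Poly_Mapping.keys_add[of p q] by blast

lemma keys_uminus [simp]: "keys (- p :: 'a \<Rightarrow>\<^sub>0 'b::ab_group_add) = keys p"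
  by (auto simp: in_keys_iff)

lemma keys_diff_subset:
  fixes p q :: "'a \<Rightarrow>\<^sub>0 'b::ab_group_add"
  shows "keys p \<subseteq> A \<Longrightarrow> keys q \<subseteq> A \<Longrightarrow> keys (p - q) \<subseteq> A"
  using keys_add_subset[of p A "- q"] by simp

lemma keys_sum_subset:
  assumes "\<And>i. i \<in> F \<Longrightarrow> keys (f i) \<subseteq> A"
  shows "keys (sum f F) \<subseteq> A"
  using assms by (induction F rule: infinite_finite_induct) (simp_all add: keys_add_subset)

lemma keys_mult_subset:
  assumes "\<And>s t. s \<in> keys p \<Longrightarrow> t \<in> keys q \<Longrightarrow> s + t \<in> A"
  shows "keys (p * q) \<subseteq> A"
  using Poly_Mapping.keys_mult[of p q] assms by blast

text \<open>By cancellation, \<open>t\<close> is the only exponent that the shift by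
  \<open>s\<close> sends to \<open>s + t\<close>, so the convolution sum collapses to one
  term.\<close>

lemma lookup_single_mult:
  fixes p :: "'a::cancel_comm_monoid_add \<Rightarrow>\<^sub>0 'b::semiring_0"
  shows "lookup (Poly_Mapping.single s c * p) (s + t) = c * lookup p t"
proof -
  have "lookup (Poly_Mapping.single s c * p) (s + t) =
      (\<Sum>l. (c * (\<Sum>q. lookup p q when s + t = l + q) when s = l))"
    by (simp add: lookup_mult lookup_single when_mult)
  also have "\<dots> = c * (\<Sum>q. lookup p q when t = q)" by simp
  also have "\<dots> = c * lookup p t" by simp
  finally show ?thesis .
qed

lemma lookup_scalar_mult:
  fixes p :: "'a::cancel_comm_monoid_add \<Rightarrow>\<^sub>0 'b::semiring_0"
  shows "lookup (Poly_Mapping.single 0 c * p) t = c * lookup p t"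
  using lookup_single_mult[of 0 c p t] by simp

lemma keys_scalar_mult: "keys (Poly_Mapping.single 0 c * p) \<subseteq> keys (p :: 'k::field polynomial)"
  by (auto simp: in_keys_iff lookup_scalar_mult)

lemma keys_monomial_mult:
  fixes p :: "'k::field polynomial"
  shows "keys (pp_poly s * p) = (\<lambda>t. s + t) ` keys p"
proof
  show "keys (pp_poly s * p) \<subseteq> (\<lambda>t. s + t) ` keys p"
    by (rule keys_mult_subset) (auto simp: pp_poly_def)
  show "(\<lambda>t. s + t) ` keys p \<subseteq> keys (pp_poly s * p)"
    by (auto simp: in_keys_iff lookup_single_mult pp_poly_def)
qed

lemma keys_pp_poly [simp]: "keys (pp_poly t :: 'k::field polynomial) = {t}"
  by (simp add: pp_poly_def)

lemma pp_poly_mult: "pp_poly s * pp_poly t = (pp_poly (s + t) :: 'k::field polynomial)"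
  by (simp add: pp_poly_def mult_single)

lemma var_power: "(var j :: 'k::field polynomial) ^ s = pp_poly (Poly_Mapping.single j s)"
  by (induction s) (simp_all add: var_def pp_poly_mult flip: single_add, simp add: pp_poly_def)

text \<open>The linear projection onto the span of the power-products in \<open>A\<close>. It serves
  twice: for homogeneous parts, and for splitting a polynomial between two monomial ideals.\<close>

definition restrict_terms :: "power_product set \<Rightarrow> 'k::field polynomial \<Rightarrow> 'k polynomial" where
  "restrict_terms A p = Poly_Mapping.mapp (\<lambda>t c. c when t \<in> A) p"

lemma lookup_restrict_terms: "lookup (restrict_terms A p) t = (lookup p t when t \<in> A)"
  by (auto simp: restrict_terms_def lookup_mapp when_def in_keys_iff)

lemma keys_restrict_terms: "keys (restrict_terms A p) = keys p \<inter> A"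
  by (auto simp: in_keys_iff lookup_restrict_terms)

lemma restrict_terms_diff: "restrict_terms A (p - q) = restrict_terms A p - restrict_terms A q"
  by (intro poly_mapping_eqI) (simp add: lookup_restrict_terms lookup_minus when_def)

lemma polynomial_eq_sum:
  assumes "finite F" "keys p \<subseteq> F"
  shows "p = (\<Sum>t\<in>F. Poly_Mapping.single 0 (lookup p t) * pp_poly t)"
  using assms
  by (intro poly_mapping_eqI)
    (auto simp: lookup_sum lookup_scalar_mult pp_poly_def lookup_single when_def in_keys_iff if_distrib
        cong: if_cong)

section \<open>The polynomial ring as an algebra, and its monomial ideals\<close>

lemma poly_ring_algebra: "algebra (cring_class_ops :: 'k::field ring) (poly_ring l)"
proof -
  have closed: "keys (p * q) \<subseteq> power_products l"
    if "keys p \<subseteq> power_products l" "keys q \<subseteq> power_products l" for p q :: "'k polynomial"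
    using that by (intro keys_mult_subset) auto
  have ab: "abelian_group (poly_ring l :: ('k, 'k polynomial) graded_ring)"
  proof (rule abelian_groupI)
    fix p :: "'k polynomial" assume "p \<in> carrier (poly_ring l)"
    then show "\<exists>q\<in>carrier (poly_ring l). q \<oplus>\<^bsub>poly_ring l\<^esub> p = \<zero>\<^bsub>poly_ring l\<^esub>"
      by (intro bexI[of _ "- p"]) auto
  qed (auto simp: add_ac intro: keys_add_subset[THEN subsetD])
  have cr: "cring (poly_ring l :: ('k, 'k polynomial) graded_ring)"
    by (intro cringI ab comm_monoidI)
      (auto simp: algebra_simps intro: closed[THEN subsetD])
  have sc: "keys p \<subseteq> power_products l \<Longrightarrow>
      keys (Poly_Mapping.single 0 c * p) \<subseteq> power_products l" for c and p :: "'k polynomial"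
    using keys_scalar_mult[of c p] by blast
  show ?thesis
    by (intro algebraI cr cring_class)
      (auto simp: algebra_simps single_add class_simps mult_single intro: sc[THEN subsetD]
        simp flip: mult.assoc)
qed

lemma poly_ring_cring: "cring (poly_ring l :: ('k::field, 'k polynomial) graded_ring)"
  using algebra.M_cring[OF poly_ring_algebra] .

lemma ideal_supported_on:
  fixes l :: nat
  assumes "\<And>s t. s \<in> power_products l \<Longrightarrow> t \<in> M \<Longrightarrow> s + t \<in> M" "M \<subseteq> power_products l"
  shows "ideal {p :: 'k::field polynomial. keys p \<subseteq> M} (poly_ring l)"
proof -
  interpret cring "poly_ring l :: ('k, 'k polynomial) graded_ring" by (rule poly_ring_cring)
  have neg: "\<ominus>\<^bsub>poly_ring l\<^esub> p = - p" if "keys p \<subseteq> power_products l" for p :: "'k polynomial"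
    using that by (intro minus_equality) auto
  show ?thesis
  proof (rule idealI[OF ring_axioms])
    show "subgroup {p :: 'k polynomial. keys p \<subseteq> M} (add_monoid (poly_ring l))"
    proof
      fix p :: "'k polynomial" assume "p \<in> {p. keys p \<subseteq> M}"
      with assms(2) show "inv\<^bsub>add_monoid (poly_ring l)\<^esub> p \<in> {p. keys p \<subseteq> M}"
        using neg[of p] by (auto simp: a_inv_def)
    qed (use assms(2) in \<open>auto intro: keys_add_subset[THEN subsetD]\<close>)
  next
    fix p q :: "'k polynomial"
    assume "p \<in> {p. keys p \<subseteq> M}" "q \<in> carrier (poly_ring l)"
    then have "keys (q * p) \<subseteq> M" by (intro keys_mult_subset) (auto intro: assms(1))
    then show "q \<otimes>\<^bsub>poly_ring l\<^esub> p \<in> {p. keys p \<subseteq> M}" "p \<otimes>\<^bsub>poly_ring l\<^esub> q \<in> {p. keys p \<subseteq> M}"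
      by (simp_all add: mult.commute)
  qed
qed

text \<open>Reduces membership in a monomial ideal to a test on the support. The right-hand side is
  an ideal containing the generators; conversely each term of such a \<open>p\<close> is a multiple
  of some generator, and \<open>p\<close> is the sum of its terms.\<close>

lemma genideal_pp_poly:
  assumes "G \<subseteq> power_products l"
  shows "Idl\<^bsub>poly_ring l\<^esub> (pp_poly ` G) = {p :: 'k::field polynomial. keys p \<subseteq> pp_multiples l G}"
    (is "?J = ?P")
proof
  interpret cring "poly_ring l :: ('k, 'k polynomial) graded_ring" by (rule poly_ring_cring)
  have "ideal ?P (poly_ring l)"
    by (intro ideal_supported_on pp_multiples_add) (auto simp: pp_multiples_def)
  moreover have "pp_poly ` G \<subseteq> ?P"
    using assms by (force simp: pp_multiples_def intro: exI[of _ 0])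
  ultimately show "?J \<subseteq> ?P" by (rule genideal_minimal)
  have sub: "pp_poly ` G \<subseteq> carrier (poly_ring l :: ('k, 'k polynomial) graded_ring)"
    using assms by auto
  interpret J: ideal ?J "poly_ring l" by (rule genideal_ideal[OF sub])
  show "?P \<subseteq> ?J"
  proof
    fix p :: "'k polynomial" assume "p \<in> ?P"
    then have p: "keys p \<subseteq> pp_multiples l G" by simp
    have mono: "Poly_Mapping.single 0 c * pp_poly t \<in> ?J" if t: "t \<in> pp_multiples l G" for c t
    proof -
      obtain g s where gs: "g \<in> G" "t = g + s" "s \<in> power_products l"
        using t by (auto simp: pp_multiples_def)
      have "pp_poly g \<in> ?J" using genideal_self[OF sub] gs(1) by blast
      moreover have "Poly_Mapping.single 0 c * pp_poly s \<in> carrier (poly_ring l)"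
        using gs(3) keys_scalar_mult[of c "pp_poly s"] by auto
      ultimately have "Poly_Mapping.single 0 c * pp_poly s * pp_poly g \<in> ?J"
        using J.I_l_closed by fastforce
      then show ?thesis by (simp add: gs(2) pp_poly_mult mult.assoc add.commute)
    qed
    \<comment> \<open>The coefficients stay those of the fixed \<open>p\<close> while the finite set
      \<open>F\<close> of exponents grows; \<open>F = keys p\<close> is taken at the end.\<close>
    have "(\<Sum>t\<in>F. Poly_Mapping.single 0 (lookup p t) * pp_poly t) \<in> ?J"
      if "finite F" "F \<subseteq> pp_multiples l G" for F
      using that
    proof (induction F)
      case empty
      then show ?case using J.zero_closed by simp
    next
      case (insert t F)
      then show ?case using J.a_closed mono by fastforce
    qed
    from this[OF finite_keys p] show "p \<in> ?J"
      by (subst polynomial_eq_sum[of "keys p"]) auto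
  qed
qed

subsection \<open>Quotients by monomial ideals\<close>

lemma (in ring_hom_ring) nat_pow_hom:
  "x \<in> carrier R \<Longrightarrow> h (x [^] (n::nat)) = h x [^]\<^bsub>S\<^esub> n"
  by (induction n) (simp_all add: R.nat_pow_Suc S.nat_pow_Suc)

lemma poly_ring_nat_pow:
  "p [^]\<^bsub>poly_ring l\<^esub> (n::nat) = (p :: 'k::field polynomial) ^ n"
  by (induction n) (simp_all add: nat_pow_def mult.commute)

text \<open>Describes a quotient of the polynomial ring by a monomial ideal through its projection
  \<open>\<phi>\<close>, with \<open>M\<close> the power-products sent to zero. Since the type of
  \<open>B\<close> is left open, cosets of polynomials and cosets of such cosets, as in an iterated
  quotient, are treated alike.\<close>

locale monomial_quotient = ring_hom_ring "poly_ring l" B \<phi>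
  for l :: nat and B :: "('k::field, 'b) graded_ring" and \<phi> :: "'k polynomial \<Rightarrow> 'b" +
  fixes M :: "power_product set"
  assumes carrier_image: "carrier B = \<phi> ` carrier (poly_ring l)"
    and smult_image: "\<And>c p. p \<in> carrier (poly_ring l) \<Longrightarrow>
      c \<odot>\<^bsub>B\<^esub> \<phi> p = \<phi> (c \<odot>\<^bsub>poly_ring l\<^esub> p)"
    and component_image: "\<And>d. component B d = \<phi> ` component (poly_ring l) d"
    and kernel_iff: "\<And>p. p \<in> carrier (poly_ring l) \<Longrightarrow> \<phi> p = \<zero>\<^bsub>B\<^esub> \<longleftrightarrow> keys p \<subseteq> M"
begin

section \<open>Algebra structure carried over from the polynomial ring\<close>

lemma phi_add:
  "keys p \<subseteq> power_products l \<Longrightarrow> keys q \<subseteq> power_products l \<Longrightarrow> \<phi> (p + q) = \<phi> p \<oplus>\<^bsub>B\<^esub> \<phi> q"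
  using hom_add[of p q] by simp

lemma phi_mult:
  "keys p \<subseteq> power_products l \<Longrightarrow> keys q \<subseteq> power_products l \<Longrightarrow> \<phi> (p * q) = \<phi> p \<otimes>\<^bsub>B\<^esub> \<phi> q"
  using hom_mult[of p q] by simp

lemma phi_closed: "keys p \<subseteq> power_products l \<Longrightarrow> \<phi> p \<in> carrier B"
  using hom_closed[of p] by simp

lemma phi_zero: "\<phi> 0 = \<zero>\<^bsub>B\<^esub>"
  using hom_zero by simp

lemma phi_eq_iff:
  assumes "keys p \<subseteq> power_products l" "keys q \<subseteq> power_products l"
  shows "\<phi> p = \<phi> q \<longleftrightarrow> keys (p - q) \<subseteq> M"
proof -
  have c: "keys (p - q) \<subseteq> power_products l" using assms by (rule keys_diff_subset)
  have "\<phi> p = \<phi> (p - q) \<oplus>\<^bsub>B\<^esub> \<phi> q" using phi_add[OF c assms(2)] by simp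
  moreover have "\<phi> (p - q) \<in> carrier B" "\<phi> q \<in> carrier B"
    using c assms phi_closed by auto
  ultimately have "\<phi> p = \<phi> q \<longleftrightarrow> \<phi> (p - q) = \<zero>\<^bsub>B\<^esub>" by simp
  with kernel_iff[of "p - q"] c show ?thesis by simp
qed

lemma scalar_closed:
  "keys p \<subseteq> power_products l \<Longrightarrow> 
    keys (Poly_Mapping.single 0 c * p) \<subseteq> power_products l" for p :: "'k polynomial"
  using keys_scalar_mult[of c p] by blast

lemma phi_smult:
  "keys p \<subseteq> power_products l \<Longrightarrow> c \<odot>\<^bsub>B\<^esub> \<phi> p = \<phi> (Poly_Mapping.single 0 c * p)"
  using smult_image[of p c] by simp

lemma carrierE:
  assumes "b \<in> carrier B"
  obtains p where "b = \<phi> p" "keys p \<subseteq> power_products l"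
  using assms carrier_image by auto

lemma componentE:
  assumes "b \<in> component B d"
  obtains p where "b = \<phi> p" "keys p \<subseteq> {t \<in> power_products l. pp_deg t = d}"
  using assms component_image by auto

lemma componentI:
  "keys p \<subseteq> {t \<in> power_products l. pp_deg t = d} \<Longrightarrow> \<phi> p \<in> component B d"
  using component_image by auto

lemma quotient_cring: "cring B"
proof -
  have "comm_monoid_axioms B"
  proof
    fix a b assume "a \<in> carrier B" "b \<in> carrier B"
    then show "a \<otimes>\<^bsub>B\<^esub> b = b \<otimes>\<^bsub>B\<^esub> a"
      by (elim carrierE) (simp add: mult.commute flip: phi_mult)
  qed
  then show ?thesis
    by (intro cring.intro S.ring_axioms comm_monoid.intro S.monoid_axioms)
qed

lemma quotient_algebra: "algebra (cring_class_ops :: 'k ring) B"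
proof (rule algebraI[OF cring_class quotient_cring])
  fix c d and x y assume "x \<in> carrier B" "y \<in> carrier B"
  then obtain p q where [simp]: "x = \<phi> p" "y = \<phi> q"
    and pq: "keys p \<subseteq> power_products l" "keys q \<subseteq> power_products l"
    by (elim carrierE)
  note cl = pq scalar_closed
  show "c \<odot>\<^bsub>B\<^esub> x \<in> carrier B"
    using cl by (simp add: phi_smult phi_closed)
  show "(c \<oplus>\<^bsub>cring_class_ops\<^esub> d) \<odot>\<^bsub>B\<^esub> x = c \<odot>\<^bsub>B\<^esub> x \<oplus>\<^bsub>B\<^esub> d \<odot>\<^bsub>B\<^esub> x"
    using cl by (simp add: phi_smult class_simps single_add distrib_right flip: phi_add)
  show "c \<odot>\<^bsub>B\<^esub> (x \<oplus>\<^bsub>B\<^esub> y) = c \<odot>\<^bsub>B\<^esub> x \<oplus>\<^bsub>B\<^esub> c \<odot>\<^bsub>B\<^esub> y"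
    using cl by (simp add: phi_smult distrib_left keys_add_subset flip: phi_add)
  show "(c \<otimes>\<^bsub>cring_class_ops\<^esub> d) \<odot>\<^bsub>B\<^esub> x = c \<odot>\<^bsub>B\<^esub> (d \<odot>\<^bsub>B\<^esub> x)"
    using cl by (simp add: phi_smult class_simps mult_single flip: mult.assoc)
  show "\<one>\<^bsub>cring_class_ops\<^esub> \<odot>\<^bsub>B\<^esub> x = x"
    using cl by (simp add: phi_smult class_simps)
  show "(c \<odot>\<^bsub>B\<^esub> x) \<otimes>\<^bsub>B\<^esub> y = c \<odot>\<^bsub>B\<^esub> (x \<otimes>\<^bsub>B\<^esub> y)"
  proof -
    have "keys (p * q) \<subseteq> power_products l" using pq by (intro keys_mult_subset) auto
    with cl show ?thesis by (simp add: phi_smult mult.assoc flip: phi_mult)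
  qed
qed

lemma phi_sum:
  assumes "finite F" "\<And>i. i \<in> F \<Longrightarrow> keys (g i) \<subseteq> power_products l"
  shows "\<phi> (\<Sum>i\<in>F. g i) = (\<Oplus>\<^bsub>B\<^esub>i\<in>F. \<phi> (g i))"
  using assms
proof (induction F)
  case empty
  then show ?case by (simp add: phi_zero)
next
  case (insert i F)
  then have "keys (\<Sum>i\<in>F. g i) \<subseteq> power_products l" by (intro keys_sum_subset) auto
  with insert show ?case
    by (subst S.finsum_insert) (auto simp: phi_add phi_closed)
qed

section \<open>Homogeneous parts and the grading of the quotient\<close>

definition part :: "nat \<Rightarrow> 'k polynomial \<Rightarrow> 'k polynomial" where
  "part d = restrict_terms {t. pp_deg t = d}"

lemma keys_part: "keys (part d p) = {t \<in> keys p. pp_deg t = d}"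
  by (auto simp: part_def keys_restrict_terms)

text \<open>The kernel is tested one exponent at a time, hence one degree at a time. This single
  equivalence yields both existence and uniqueness of the homogeneous decomposition.\<close>

lemma phi_eq_finsum_iff:
  assumes F: "finite F" and p: "keys p \<subseteq> power_products l"
    and g: "\<And>d. d \<in> F \<Longrightarrow> keys (g d) \<subseteq> {t \<in> power_products l. pp_deg t = d}"
  shows "\<phi> p = (\<Oplus>\<^bsub>B\<^esub>d\<in>F. \<phi> (g d)) \<longleftrightarrow>
    (\<forall>d. \<phi> (part d p) = (if d \<in> F then \<phi> (g d) else \<zero>\<^bsub>B\<^esub>))"
proof -
  define q where "q = (\<Sum>d\<in>F. g d)"
  \<comment> \<open>Extending by zero outside \<open>F\<close> lets both sides be compared in every
    degree, including those where \<open>p\<close> must become zero in the quotient.\<close>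
  define g' where "g' d = (if d \<in> F then g d else 0)" for d
  have gl: "keys (g d) \<subseteq> power_products l" if "d \<in> F" for d
    using g[OF that] by auto
  have g'l: "keys (g' d) \<subseteq> power_products l" for d using gl by (simp add: g'_def)
  have q: "keys q \<subseteq> power_products l" unfolding q_def using gl by (intro keys_sum_subset)
  have pl: "keys (part d p) \<subseteq> power_products l" for d using p by (auto simp: keys_part)
  have g0: "lookup (g e) t = 0" if "e \<in> F" "pp_deg t \<noteq> e" for e t
    using g[OF that(1)] that(2) by (auto simp: in_keys_iff subset_iff)
  have part_q: "part d q = g' d" for d
  proof (rule poly_mapping_eqI)
    fix t
    have "lookup q t = (\<Sum>e\<in>F. lookup (g e) t when e = pp_deg t)"
      unfolding q_def lookup_sum using g0 by (intro sum.cong) (auto simp: when_def)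
    also have "\<dots> = (if pp_deg t \<in> F then lookup (g (pp_deg t)) t else 0)"
      using F by (simp add: when_def)
    finally show "lookup (part d q) t = lookup (g' d) t"
      using g0[of d t] by (auto simp: part_def lookup_restrict_terms g'_def when_def)
  qed
  have "\<phi> p = (\<Oplus>\<^bsub>B\<^esub>d\<in>F. \<phi> (g d)) \<longleftrightarrow> \<phi> p = \<phi> q"
    unfolding q_def using phi_sum[OF F gl] by simp
  also have "\<dots> \<longleftrightarrow> keys (p - q) \<subseteq> M" using p q by (rule phi_eq_iff)
  also have "\<dots> \<longleftrightarrow> (\<forall>d. keys (part d (p - q)) \<subseteq> M)"
    by (auto simp: keys_part)
  also have "\<dots> \<longleftrightarrow> (\<forall>d. keys (part d p - g' d) \<subseteq> M)"
    unfolding part_q[symmetric] by (simp add: part_def restrict_terms_diff)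
  also have "\<dots> \<longleftrightarrow> (\<forall>d. \<phi> (part d p) = \<phi> (g' d))"
    using phi_eq_iff[OF pl g'l] by simp
  also have "\<dots> \<longleftrightarrow> (\<forall>d. \<phi> (part d p) = (if d \<in> F then \<phi> (g d) else \<zero>\<^bsub>B\<^esub>))"
    by (simp add: g'_def phi_zero if_distrib cong: if_cong)
  finally show ?thesis .
qed

lemma quotient_direct_sum:
  assumes "a \<in> carrier B"
  shows "\<exists>!f. (\<forall>i. f i \<in> component B i) \<and> finite {i. f i \<noteq> \<zero>\<^bsub>B\<^esub>} \<and>
    a = (\<Oplus>\<^bsub>B\<^esub>i\<in>{i. f i \<noteq> \<zero>\<^bsub>B\<^esub>}. f i)"
proof -
  obtain p where a: "a = \<phi> p" and p: "keys p \<subseteq> power_products l"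
    using assms by (rule carrierE)
  let ?f = "\<lambda>d. \<phi> (part d p)"
  have pd: "keys (part d p) \<subseteq> {t \<in> power_products l. pp_deg t = d}" for d
    using p by (auto simp: keys_part)
  have "{d. ?f d \<noteq> \<zero>\<^bsub>B\<^esub>} \<subseteq> pp_deg ` keys p"
  proof
    fix d assume "d \<in> {d. ?f d \<noteq> \<zero>\<^bsub>B\<^esub>}"
    then have "part d p \<noteq> 0" using phi_zero by auto
    then have "keys (part d p) \<noteq> {}" by simp
    then show "d \<in> pp_deg ` keys p" by (auto simp: keys_part)
  qed
  then have fin: "finite {d. ?f d \<noteq> \<zero>\<^bsub>B\<^esub>}" by (rule finite_subset) simp
  show ?thesis
  proof (rule ex1I[of _ ?f], intro conjI allI)
    show "?f d \<in> component B d" for d using pd by (rule componentI)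
    \<comment> \<open>The index set is exactly the support of \<open>?f\<close>, so the default
      value zero off that set is the correct one.\<close>
    show "a = (\<Oplus>\<^bsub>B\<^esub>d\<in>{d. ?f d \<noteq> \<zero>\<^bsub>B\<^esub>}. ?f d)"
      unfolding a by (subst phi_eq_finsum_iff[OF fin p pd]) auto
  next
    fix f
    assume f: "(\<forall>i. f i \<in> component B i) \<and> finite {i. f i \<noteq> \<zero>\<^bsub>B\<^esub>} \<and>
      a = (\<Oplus>\<^bsub>B\<^esub>i\<in>{i. f i \<noteq> \<zero>\<^bsub>B\<^esub>}. f i)"
    then have "\<forall>i. \<exists>q. f i = \<phi> q \<and> keys q \<subseteq> {t \<in> power_products l. pp_deg t = i}"
    proof (intro allI)
      fix i
      have "f i \<in> component B i" using f by blast
      then show "\<exists>q. f i = \<phi> q \<and> keys q \<subseteq> {t \<in> power_products l. pp_deg t = i}"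
        by (rule componentE) blast
    qed
    then obtain g where g: "\<And>i. f i = \<phi> (g i)"
        "\<And>i. keys (g i) \<subseteq> {t \<in> power_products l. pp_deg t = i}"
      by metis
    have fin: "finite {i. f i \<noteq> \<zero>\<^bsub>B\<^esub>}" using f by simp
    have "\<phi> p = (\<Oplus>\<^bsub>B\<^esub>i\<in>{i. f i \<noteq> \<zero>\<^bsub>B\<^esub>}. \<phi> (g i))"
      using f a by (simp flip: g(1))
    then have "\<forall>d. \<phi> (part d p) = (if d \<in> {i. f i \<noteq> \<zero>\<^bsub>B\<^esub>} then \<phi> (g d) else \<zero>\<^bsub>B\<^esub>)"
      by (subst (asm) phi_eq_finsum_iff[OF fin p g(2)])
    then show "f = ?f" by (auto simp: g(1))
  qed (fact fin)
qed

text \<open>The classes of the standard power-products of degree \<open>d\<close>, those outside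
  \<open>M\<close>, span the component, and only finitely many power-products have degree
  \<open>d\<close>.\<close>

lemma quotient_component_spanned:
  "\<exists>C. finite C \<and> C \<subseteq> component B d \<and> (\<forall>a\<in>component B d.
    \<exists>c\<in>C \<rightarrow> carrier (cring_class_ops :: 'k ring). a = (\<Oplus>\<^bsub>B\<^esub>b\<in>C. c b \<odot>\<^bsub>B\<^esub> b))"
proof -
  define T where "T = {t \<in> power_products l. pp_deg t = d} - M"
  define e :: "power_product \<Rightarrow> 'b" where "e t = \<phi> (pp_poly t)" for t
  have finT: "finite T" unfolding T_def by (intro finite_Diff finite_pp_degree)
  \<comment> \<open>Needed to reindex the sum from exponents to their classes. If \<open>s\<close>
    and \<open>t\<close> differ, \<open>s\<close> is a key of the difference, although it lies
    outside \<open>M\<close>.\<close>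
  have inj: "inj_on e T"
  proof
    fix s t assume st: "s \<in> T" "t \<in> T" "e s = e t"
    then have "keys (pp_poly s - pp_poly t :: 'k polynomial) \<subseteq> M"
      unfolding e_def by (subst (asm) phi_eq_iff) (auto simp: T_def)
    with st(1) have "s \<notin> keys (pp_poly s - pp_poly t :: 'k polynomial)" by (auto simp: T_def)
    then show "s = t" by (auto simp: in_keys_iff pp_poly_def lookup_minus lookup_single when_def
          split: if_splits)
  qed
  have span: "\<exists>c\<in>e ` T \<rightarrow> carrier (cring_class_ops :: 'k ring).
      a = (\<Oplus>\<^bsub>B\<^esub>b\<in>e ` T. c b \<odot>\<^bsub>B\<^esub> b)" if a_in: "a \<in> component B d" for a
  proof -
    obtain p where a: "a = \<phi> p" and p: "keys p \<subseteq> {t \<in> power_products l. pp_deg t = d}"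
      using a_in by (rule componentE)
    define c where "c b = lookup p (inv_into T e b)" for b
    \<comment> \<open>\<open>q\<close> keeps the standard terms of \<open>p\<close>; the discarded
      terms have exponents in \<open>M\<close>, so \<open>p\<close> and \<open>q\<close> have the
      same class.\<close>
    define q where "q = (\<Sum>t\<in>T. Poly_Mapping.single 0 (lookup p t) * pp_poly t)"
    have tl: "keys (Poly_Mapping.single 0 (lookup p t) * pp_poly t) \<subseteq> power_products l"
      if "t \<in> T" for t
      using that by (intro scalar_closed) (auto simp: T_def)
    have lq: "lookup q t = (lookup p t when t \<in> T)" for t
      using finT unfolding q_def
      by (simp add: lookup_sum lookup_scalar_mult pp_poly_def lookup_single when_def if_distrib
          cong: if_cong)
    have "keys q \<subseteq> power_products l" unfolding q_def using tl by (rule keys_sum_subset)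
    moreover have "keys (p - q) \<subseteq> M"
      using p by (auto simp: in_keys_iff lookup_minus lq T_def subset_iff when_def split: if_splits)
    ultimately have "a = \<phi> q" unfolding a using p by (subst phi_eq_iff) auto
    also have "\<dots> = (\<Oplus>\<^bsub>B\<^esub>t\<in>T. \<phi> (Poly_Mapping.single 0 (lookup p t) * pp_poly t))"
      unfolding q_def using finT tl by (rule phi_sum)
    also have "\<dots> = (\<Oplus>\<^bsub>B\<^esub>t\<in>T. c (e t) \<odot>\<^bsub>B\<^esub> e t)"
    proof (rule S.finsum_cong')
      fix t assume t: "t \<in> T"
      then have ce: "c (e t) = lookup p t" using inj by (simp add: c_def)
      show "\<phi> (Poly_Mapping.single 0 (lookup p t) * pp_poly t) = c (e t) \<odot>\<^bsub>B\<^esub> e t"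
        unfolding ce unfolding e_def using t by (subst phi_smult) (auto simp: T_def)
    qed (auto simp: e_def T_def phi_smult intro!: phi_closed scalar_closed)
    also have "\<dots> = (\<Oplus>\<^bsub>B\<^esub>b\<in>e ` T. c b \<odot>\<^bsub>B\<^esub> b)"
    proof (rule S.finsum_reindex[symmetric])
      show "(\<lambda>b. c b \<odot>\<^bsub>B\<^esub> b) \<in> e ` T \<rightarrow> carrier B"
        by (auto simp: e_def T_def phi_smult intro!: phi_closed scalar_closed)
    qed (fact inj)
    finally show ?thesis by (intro bexI[of _ c]) (auto simp: carrier_class)
  qed
  have "e ` T \<subseteq> component B d" by (auto simp: e_def T_def intro!: componentI)
  with finT span show ?thesis by blast
qed

lemma quotient_graded_algebra: "graded_algebra (cring_class_ops :: 'k ring) B"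
proof (intro graded_algebra.intro quotient_algebra graded_algebra_axioms.intro field_class
    quotient_direct_sum quotient_component_spanned)
  interpret alg: algebra "cring_class_ops :: 'k ring" B by (rule quotient_algebra)
  fix d
  have cl: "component B d \<subseteq> carrier B"
    unfolding component_image carrier_image by auto
  have sm: "c \<odot>\<^bsub>B\<^esub> a \<in> component B d" if "a \<in> component B d" for a c
    using that
  proof (rule componentE)
    fix p assume "a = \<phi> p" "keys p \<subseteq> {t \<in> power_products l. pp_deg t = d}"
    moreover from this(2) have "keys p \<subseteq> power_products l" by auto
    ultimately show ?thesis
      using keys_scalar_mult[of c p] by (auto simp: phi_smult intro!: componentI)
  qed
  show "submodule (component B d) (cring_class_ops :: 'k ring) B"
  proof (rule alg.submoduleI[OF cl])
    show "\<zero>\<^bsub>B\<^esub> \<in> component B d" using componentI[of 0 d] by (simp add: phi_zero)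
    show "\<ominus>\<^bsub>B\<^esub> a \<in> component B d" if a: "a \<in> component B d" for a
    proof -
      have "\<ominus>\<^bsub>B\<^esub> a = (\<ominus>\<^bsub>cring_class_ops\<^esub> 1) \<odot>\<^bsub>B\<^esub> a"
        using alg.smult_l_minus[of 1 a] alg.smult_one[of a] a cl by (auto simp: class_simps)
      then show ?thesis using sm[OF a] by simp
    qed
    show "a \<oplus>\<^bsub>B\<^esub> b \<in> component B d" if ab: "a \<in> component B d" "b \<in> component B d" for a b
    proof -
      obtain p q where pq: "a = \<phi> p" "b = \<phi> q"
        "keys p \<subseteq> {t \<in> power_products l. pp_deg t = d}"
        "keys q \<subseteq> {t \<in> power_products l. pp_deg t = d}"
        using ab by (elim componentE)
      then have "a \<oplus>\<^bsub>B\<^esub> b = \<phi> (p + q)" by (subst phi_add) auto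
      moreover have "\<phi> (p + q) \<in> component B d"
        using pq(3,4) by (intro componentI keys_add_subset)
      ultimately show ?thesis by simp
    qed
  qed (rule sm)
next
  fix d e a b assume "a \<in> component B d" "b \<in> component B e"
  then obtain p q where pq: "a = \<phi> p" "b = \<phi> q"
    "keys p \<subseteq> {t \<in> power_products l. pp_deg t = d}"
    "keys q \<subseteq> {t \<in> power_products l. pp_deg t = e}"
    by (elim componentE)
  then have "a \<otimes>\<^bsub>B\<^esub> b = \<phi> (p * q)" by (subst phi_mult) auto
  moreover have "\<phi> (p * q) \<in> component B (d + e)"
    using pq(3,4) by (intro componentI keys_mult_subset) auto
  ultimately show "a \<otimes>\<^bsub>B\<^esub> b \<in> component B (d + e)" by simp
qed

text \<open>Multiplication by \<open>x_j^s\<close> shifts exponents injectively, so no terms cancel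
  and full rank can be read off from power-products. If no standard exponent is shifted into
  \<open>M\<close>, the kernel in degree \<open>d\<close> is trivial; if every standard exponent of
  degree \<open>d + s\<close> is divisible by \<open>x_j^s\<close>, each class has a preimage
  obtained by division.\<close>

lemma variable_has_slp:
  assumes j: "j \<in> {1..l}"
    and dichotomy: "\<And>d s.
      (\<forall>t\<in>power_products l. pp_deg t = d \<and> t \<notin> M \<longrightarrow> Poly_Mapping.single j s + t \<notin> M) \<or>
      (\<forall>m\<in>power_products l. pp_deg m = d + s \<and> m \<notin> M \<longrightarrow> s \<le> lookup m j)"
  shows "has_slp (cring_class_ops :: 'k ring) B (\<phi> (var j))"
  unfolding has_slp_def
proof (intro conjI allI impI)
  show "\<phi> (var j) \<in> component B 1"
    using j by (intro componentI) (auto simp: var_def)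
  fix d s :: nat
  let ?x = "pp_poly (Poly_Mapping.single j s) :: 'k polynomial"
  let ?f = "\<lambda>a. \<phi> (var j) [^]\<^bsub>B\<^esub> s \<otimes>\<^bsub>B\<^esub> a"
  have "\<phi> (var j) [^]\<^bsub>B\<^esub> s = \<phi> ?x"
    using nat_pow_hom[of "var j" s] j by (simp add: poly_ring_nat_pow var_power) (simp add: var_def)
  moreover have x: "keys ?x \<subseteq> power_products l" using j by simp
  ultimately have f: "?f (\<phi> p) = \<phi> (?x * p)" if "keys p \<subseteq> power_products l" for p
    using that by (simp add: phi_mult)
  have xp: "keys (?x * p) \<subseteq> {t \<in> power_products l. pp_deg t = d + s}"
    if "keys p \<subseteq> {t \<in> power_products l. pp_deg t = d}" for p
    unfolding keys_monomial_mult using that j by auto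
  from dichotomy[of d s] show "full_rank ?f (component B d) (component B (d + s))"
    unfolding full_rank_def
  proof (rule disj_forward)
    assume D: "\<forall>t\<in>power_products l. pp_deg t = d \<and> t \<notin> M \<longrightarrow> Poly_Mapping.single j s + t \<notin> M"
    show "inj_on ?f (component B d)"
    proof
      fix a b assume "a \<in> component B d" "b \<in> component B d" and eq: "?f a = ?f b"
      then obtain p q where [simp]: "a = \<phi> p" "b = \<phi> q"
        and pq: "keys p \<subseteq> {t \<in> power_products l. pp_deg t = d}"
          "keys q \<subseteq> {t \<in> power_products l. pp_deg t = d}"
        by (elim componentE)
      have pl: "keys p \<subseteq> power_products l" "keys q \<subseteq> power_products l" using pq by auto
      have xl: "keys (?x * p) \<subseteq> power_products l" "keys (?x * q) \<subseteq> power_products l"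
        using xp[OF pq(1)] xp[OF pq(2)] by auto
      have "keys (?x * p - ?x * q) \<subseteq> M"
        using eq pl xl by (simp add: f phi_eq_iff)
      then have "keys (?x * (p - q)) \<subseteq> M" by (simp add: right_diff_distrib)
      \<comment> \<open>The support of the product is exactly the shifted support of
        \<open>p - q\<close>, so each key can be treated separately.\<close>
      then have "Poly_Mapping.single j s + t \<in> M" if "t \<in> keys (p - q)" for t
        using that unfolding keys_monomial_mult by blast
      moreover have "keys (p - q) \<subseteq> {t \<in> power_products l. pp_deg t = d}"
        using pq by (rule keys_diff_subset)
      ultimately have "keys (p - q) \<subseteq> M" using D by blast
      with pl show "a = b" by (simp add: phi_eq_iff)
    qed
  next
    assume D: "\<forall>m\<in>power_products l. pp_deg m = d + s \<and> m \<notin> M \<longrightarrow> s \<le> lookup m j"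
    show "?f ` component B d = component B (d + s)"
    proof (intro equalityI subsetI)
      fix b assume "b \<in> ?f ` component B d"
      then obtain a where "a \<in> component B d" "b = ?f a" by blast
      then obtain p where "b = ?f (\<phi> p)" "keys p \<subseteq> {t \<in> power_products l. pp_deg t = d}"
        by (metis componentE)
      moreover from this(2) have "keys p \<subseteq> power_products l" by auto
      ultimately show "b \<in> component B (d + s)" using xp by (simp add: f componentI)
    next
      fix b assume "b \<in> component B (d + s)"
      then obtain p where b: "b = \<phi> p"
        and p: "keys p \<subseteq> {t \<in> power_products l. pp_deg t = d + s}"
        by (rule componentE)
      have inj: "inj (\<lambda>t. Poly_Mapping.single j s + t)" by (rule injI) simp
      \<comment> \<open>The quotient of \<open>p\<close> by \<open>x_j^s\<close>, with the terms not
        divisible by \<open>x_j^s\<close> dropped. Those terms lie in \<open>M\<close> by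
        \<open>D\<close>, so \<open>x_j^s q\<close> still represents \<open>b\<close>.\<close>
      define q where "q = Poly_Mapping.map_key (\<lambda>t. Poly_Mapping.single j s + t) p"
      have lq: "lookup q t = lookup p (Poly_Mapping.single j s + t)" for t
        unfolding q_def using inj by (simp add: map_key.rep_eq)
      have kq: "keys q \<subseteq> {t \<in> power_products l. pp_deg t = d}"
      proof
        fix t assume "t \<in> keys q"
        then have "Poly_Mapping.single j s + t \<in> keys p" by (simp add: in_keys_iff lq)
        with p show "t \<in> {t \<in> power_products l. pp_deg t = d}" by auto
      qed
      then have ql: "keys q \<subseteq> power_products l" by auto
      have "keys (p - ?x * q) \<subseteq> M"
      proof
        fix m assume m: "m \<in> keys (p - ?x * q)"
        have "keys (p - ?x * q) \<subseteq> {t \<in> power_products l. pp_deg t = d + s}"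
          using p xp[OF kq] by (rule keys_diff_subset)
        with m have md: "m \<in> power_products l" "pp_deg m = d + s" by auto
        show "m \<in> M"
        proof (rule ccontr)
          assume "m \<notin> M"
          with D md have "s \<le> lookup m j" by blast
          then obtain t where "m = Poly_Mapping.single j s + t" by (rule pp_split_variable)
          then have "lookup (p - ?x * q) m = 0"
            unfolding pp_poly_def by (simp add: lookup_minus lookup_single_mult lq)
          with m show False by (simp add: in_keys_iff)
        qed
      qed
      moreover have "keys p \<subseteq> power_products l" "keys (?x * q) \<subseteq> power_products l"
        using p xp[OF kq] by auto
      ultimately have "b = ?f (\<phi> q)" using ql by (simp add: b f phi_eq_iff)
      then show "b \<in> ?f ` component B d" using componentI[OF kq] by blast
    qed
  qed
qed (fact quotient_graded_algebra)

end

subsection \<open>Iterated quotients\<close>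

lemma image_ideal:
  assumes "ring_hom_ring R S h" "h ` carrier R = carrier S" "ideal J R"
  shows "ideal (h ` J) S"
proof -
  interpret ring_hom_ring R S h by fact
  interpret J: ideal J R by fact
  show ?thesis
  proof (rule idealI[OF S.ring_axioms])
    show "subgroup (h ` J) (add_monoid S)"
      using img_is_add_subgroup[OF J.a_subgroup] .
  next
    fix a x assume "a \<in> h ` J" "x \<in> carrier S"
    moreover from this(2) obtain r where "r \<in> carrier R" "x = h r"
      using assms(2) by (metis imageE)
    ultimately obtain i r where ir: "i \<in> J" "a = h i" "r \<in> carrier R" "x = h r"
      by blast
    then have "x \<otimes>\<^bsub>S\<^esub> a = h (r \<otimes>\<^bsub>R\<^esub> i)" "a \<otimes>\<^bsub>S\<^esub> x = h (i \<otimes>\<^bsub>R\<^esub> r)"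
      by (simp_all add: J.Icarr)
    moreover have "r \<otimes>\<^bsub>R\<^esub> i \<in> J" "i \<otimes>\<^bsub>R\<^esub> r \<in> J"
      using ir by (auto intro: J.I_l_closed J.I_r_closed)
    ultimately show "x \<otimes>\<^bsub>S\<^esub> a \<in> h ` J" "a \<otimes>\<^bsub>S\<^esub> x \<in> h ` J" by simp_all
  qed
qed

lemma genideal_image:
  assumes hom: "ring_hom_ring R S h" and surj: "h ` carrier R = carrier S"
    and X: "X \<subseteq> carrier R"
  shows "Idl\<^bsub>S\<^esub> (h ` X) = h ` (Idl\<^bsub>R\<^esub> X)"
proof
  interpret ring_hom_ring R S h by fact
  have "ideal (h ` (Idl\<^bsub>R\<^esub> X)) S"
    using hom surj R.genideal_ideal[OF X] by (rule image_ideal)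
  then show "Idl\<^bsub>S\<^esub> (h ` X) \<subseteq> h ` (Idl\<^bsub>R\<^esub> X)"
    by (rule S.genideal_minimal) (rule image_mono[OF R.genideal_self[OF X]])
  have hX: "h ` X \<subseteq> carrier S" using X surj by blast
  have "Idl\<^bsub>R\<^esub> X \<subseteq> {r \<in> carrier R. h r \<in> Idl\<^bsub>S\<^esub> (h ` X)}"
    by (rule R.genideal_minimal[OF ideal_vimage[OF S.genideal_ideal[OF hX]]])
      (use X S.genideal_self[OF hX] in auto)
  then show "h ` (Idl\<^bsub>R\<^esub> X) \<subseteq> Idl\<^bsub>S\<^esub> (h ` X)" by blast
qed

section \<open>The coset map onto a graded quotient\<close>

context
  fixes K :: "('k, 'm) ring_scheme" and A :: "('k, 'a) graded_ring" and J :: "'a set"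
  assumes algebra: "algebra K A" and ideal: "ideal J A"
begin

interpretation algebra K A by (rule algebra)
interpretation ideal J A by (rule ideal)

lemma graded_quot_carrier: "carrier (graded_quot A J) = (\<lambda>a. J +>\<^bsub>A\<^esub> a) ` carrier A"
  by (auto simp: graded_quot_def FactRing_simps)

lemma graded_quot_component: "component (graded_quot A J) d = (\<lambda>a. J +>\<^bsub>A\<^esub> a) ` component A d"
  by (simp add: graded_quot_def)

lemma graded_quot_zero_iff:
  assumes "a \<in> carrier A"
  shows "J +>\<^bsub>A\<^esub> a = \<zero>\<^bsub>graded_quot A J\<^esub> \<longleftrightarrow> a \<in> J"
  using a_rcos_self[OF assms] a_rcos_const[of a]
  by (auto simp: graded_quot_def FactRing_def)

lemma graded_quot_hom: "ring_hom_ring A (graded_quot A J) (\<lambda>a. J +>\<^bsub>A\<^esub> a)"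
proof (rule ring_hom_ringI2)
  interpret Q: ring "A Quot J" by (rule quotient_is_ring)
  show "ring A" by (rule cring.axioms(1)[OF M_cring])
  show hom: "(\<lambda>a. J +>\<^bsub>A\<^esub> a) \<in> ring_hom A (graded_quot A J)"
    using rcos_ring_hom by (auto simp: ring_hom_def graded_quot_def)
  \<comment> \<open>The ring axioms are obtained from the image of a ring under a homomorphism. That
    image ring carries its own carrier and zero, which have to be identified with those of
    \<open>graded_quot A J\<close>.\<close>
  have "graded_quot A J\<lparr>carrier := (\<lambda>a. J +>\<^bsub>A\<^esub> a) ` carrier A,
      zero := J +>\<^bsub>A\<^esub> \<zero>\<^bsub>A\<^esub>\<rparr> = graded_quot A J"
  proof (rule graded_ring.equality)
    show "zero (graded_quot A J\<lparr>carrier := (\<lambda>a. J +>\<^bsub>A\<^esub> a) ` carrier A,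
        zero := J +>\<^bsub>A\<^esub> \<zero>\<^bsub>A\<^esub>\<rparr>) = zero (graded_quot A J)"
      using a_rcos_const[OF zero_closed] by (simp add: graded_quot_def FactRing_def)
  qed (simp_all add: graded_quot_carrier)
  with ring.ring_hom_imp_img_ring[OF cring.axioms(1)[OF M_cring] hom]
  show "ring (graded_quot A J)" by (simp only:)
qed

lemma graded_quot_smult:
  assumes "c \<in> carrier K" "a \<in> carrier A"
  shows "c \<odot>\<^bsub>graded_quot A J\<^esub> (J +>\<^bsub>A\<^esub> a) = J +>\<^bsub>A\<^esub> (c \<odot>\<^bsub>A\<^esub> a)"
proof -
  have "J +>\<^bsub>A\<^esub> (c \<odot>\<^bsub>A\<^esub> x) = J +>\<^bsub>A\<^esub> (c \<odot>\<^bsub>A\<^esub> a)" if x: "x \<in> J +>\<^bsub>A\<^esub> a" for x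
  proof -
    obtain i where i: "i \<in> J" "x = i \<oplus>\<^bsub>A\<^esub> a"
      using x by (auto simp: a_r_coset_def')
    \<comment> \<open>Ideals absorb ring elements, so a scalar is first turned into the ring element
      \<open>c\<close> times one.\<close>
    have "c \<odot>\<^bsub>A\<^esub> i = (c \<odot>\<^bsub>A\<^esub> \<one>\<^bsub>A\<^esub>) \<otimes>\<^bsub>A\<^esub> i"
      using assms i by (simp add: smult_assoc2 Icarr)
    also have "\<dots> \<in> J" using i assms by (intro I_l_closed) auto
    finally have ci: "c \<odot>\<^bsub>A\<^esub> i \<in> J" .
    have "c \<odot>\<^bsub>A\<^esub> x = c \<odot>\<^bsub>A\<^esub> i \<oplus>\<^bsub>A\<^esub> c \<odot>\<^bsub>A\<^esub> a"
      using assms i by (simp add: smult_r_distr Icarr)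
    then have "c \<odot>\<^bsub>A\<^esub> x \<in> J +>\<^bsub>A\<^esub> (c \<odot>\<^bsub>A\<^esub> a)"
      using ci by (auto simp: a_r_coset_def')
    then show ?thesis
      using a_repr_independence[OF _ smult_closed a_subgroup] assms by simp
  qed
  then have "(\<Union>x\<in>J +>\<^bsub>A\<^esub> a. J +>\<^bsub>A\<^esub> (c \<odot>\<^bsub>A\<^esub> x)) =
      (\<Union>x\<in>J +>\<^bsub>A\<^esub> a. J +>\<^bsub>A\<^esub> (c \<odot>\<^bsub>A\<^esub> a))"
    by (rule SUP_cong[OF refl])
  \<comment> \<open>The union defining the scalar product now has constant members; being over a
    nonempty set, it equals that constant.\<close>
  moreover have "J +>\<^bsub>A\<^esub> a \<noteq> {}" using a_rcos_self[OF assms(2)] by blast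
  ultimately show ?thesis by (simp add: graded_quot_def)
qed

end

lemma monomial_quotient_of_poly_ring:
  assumes "G \<subseteq> power_products l" and I: "I = Idl\<^bsub>poly_ring l\<^esub> (pp_poly ` G)"
  shows "monomial_quotient l (graded_quot (poly_ring l) I)
    (\<lambda>p. I +>\<^bsub>poly_ring l\<^esub> (p :: 'k::field polynomial)) (pp_multiples l G)"
proof -
  interpret S: cring "poly_ring l :: ('k, 'k polynomial) graded_ring" by (rule poly_ring_cring)
  have ideal: "ideal I (poly_ring l)" unfolding I using assms(1) by (intro S.genideal_ideal) auto
  note quot = poly_ring_algebra ideal
  show ?thesis
  proof (intro monomial_quotient.intro monomial_quotient_axioms.intro)
    show "ring_hom_ring (poly_ring l) (graded_quot (poly_ring l) I) (\<lambda>p. I +>\<^bsub>poly_ring l\<^esub> p)"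
      by (rule graded_quot_hom[OF quot])
  next
    fix c :: 'k and p :: "'k polynomial" assume "p \<in> carrier (poly_ring l)"
    then show "c \<odot>\<^bsub>graded_quot (poly_ring l) I\<^esub> (I +>\<^bsub>poly_ring l\<^esub> p) =
        I +>\<^bsub>poly_ring l\<^esub> (c \<odot>\<^bsub>poly_ring l\<^esub> p)"
      by (rule graded_quot_smult[OF quot carrier_class])
  next
    fix p :: "'k polynomial" assume "p \<in> carrier (poly_ring l)"
    from graded_quot_zero_iff[OF quot this]
    show "I +>\<^bsub>poly_ring l\<^esub> p = \<zero>\<^bsub>graded_quot (poly_ring l) I\<^esub> \<longleftrightarrow>
        keys p \<subseteq> pp_multiples l G"
      unfolding I genideal_pp_poly[OF assms(1)] by simp
  qed (rule graded_quot_carrier[OF quot] graded_quot_component[OF quot])+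
qed

text \<open>\<open>J\<close> is the image of a monomial ideal of the polynomial ring, so the kernel
  of the composite projection is the sum of two monomial ideals, and their exponent sets are united.
  This keeps every quotient in the \<open>l\<close>-SLP within the same locale.\<close>

lemma (in monomial_quotient) further_quotient:
  assumes E: "E \<subseteq> power_products l" and J: "J = Idl\<^bsub>B\<^esub> (\<phi> ` pp_poly ` E)"
  shows "monomial_quotient l (graded_quot B J) (\<lambda>p. J +>\<^bsub>B\<^esub> \<phi> p) (M \<union> pp_multiples l E)"
proof -
  have gens: "(pp_poly ` E :: 'k polynomial set) \<subseteq> carrier (poly_ring l)" using E by auto
  have J': "J = \<phi> ` {p. keys p \<subseteq> pp_multiples l E}"
    unfolding J genideal_image[OF ring_hom_ring_axioms carrier_image[symmetric] gens]
    by (simp only: genideal_pp_poly[OF E])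
  have "ideal J B" unfolding J using E by (intro S.genideal_ideal) (auto intro!: phi_closed)
  note quot = quotient_algebra this
  interpret Q: ring_hom_ring B "graded_quot B J" "\<lambda>b. J +>\<^bsub>B\<^esub> b"
    by (rule graded_quot_hom[OF quot])
  show ?thesis
  proof (intro monomial_quotient.intro monomial_quotient_axioms.intro ring_hom_ringI2)
    show "ring (poly_ring l :: ('k, 'k polynomial) graded_ring)"
      by (rule ring_hom_ring.axioms(1)[OF ring_hom_ring_axioms])
    show "ring (graded_quot B J)" by (fact Q.S.ring_axioms)
    show "(\<lambda>p. J +>\<^bsub>B\<^esub> \<phi> p) \<in> ring_hom (poly_ring l) (graded_quot B J)"
      using ring_hom_trans[OF homh Q.homh] by (simp add: comp_def)
    show "carrier (graded_quot B J) = (\<lambda>p. J +>\<^bsub>B\<^esub> \<phi> p) ` carrier (poly_ring l)"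
      unfolding graded_quot_carrier[OF quot] carrier_image by (simp only: image_image)
    show "component (graded_quot B J) d = (\<lambda>p. J +>\<^bsub>B\<^esub> \<phi> p) ` component (poly_ring l) d" for d
      unfolding graded_quot_component[OF quot] component_image by (simp only: image_image)
  next
    fix c :: 'k and p :: "'k polynomial" assume p: "p \<in> carrier (poly_ring l)"
    show "c \<odot>\<^bsub>graded_quot B J\<^esub> (J +>\<^bsub>B\<^esub> \<phi> p) = J +>\<^bsub>B\<^esub> \<phi> (c \<odot>\<^bsub>poly_ring l\<^esub> p)"
      unfolding graded_quot_smult[OF quot carrier_class hom_closed[OF p]] smult_image[OF p] ..
  next
    fix p :: "'k polynomial" assume p: "p \<in> carrier (poly_ring l)"
    then have pl: "keys p \<subseteq> power_products l" by simp
    have El: "pp_multiples l E \<subseteq> power_products l" by (auto simp: pp_multiples_def)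
    have "J +>\<^bsub>B\<^esub> \<phi> p = \<zero>\<^bsub>graded_quot B J\<^esub> \<longleftrightarrow> \<phi> p \<in> J"
      by (rule graded_quot_zero_iff[OF quot hom_closed[OF p]])
    also have "\<dots> \<longleftrightarrow> (\<exists>q. keys q \<subseteq> pp_multiples l E \<and> keys (p - q) \<subseteq> M)"
      unfolding J' using phi_eq_iff[OF pl] El by (auto simp: image_iff)
    also have "\<dots> \<longleftrightarrow> keys p \<subseteq> M \<union> pp_multiples l E"
    proof
      assume "\<exists>q. keys q \<subseteq> pp_multiples l E \<and> keys (p - q) \<subseteq> M"
      then obtain q where q: "keys q \<subseteq> pp_multiples l E" "keys (p - q) \<subseteq> M" by blast
      then have "keys ((p - q) + q) \<subseteq> M \<union> pp_multiples l E" by (intro keys_add_subset) auto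
      then show "keys p \<subseteq> M \<union> pp_multiples l E" by simp
    next
      assume pM: "keys p \<subseteq> M \<union> pp_multiples l E"
      \<comment> \<open>Terms with exponent in \<open>M\<close> vanish already in \<open>B\<close>;
        all other terms of \<open>p\<close> have exponents in \<open>pp_multiples l E\<close> and
        form the representative in \<open>J\<close>.\<close>
      let ?q = "restrict_terms (- M) p"
      have "p - ?q = restrict_terms M p"
        by (intro poly_mapping_eqI) (simp add: lookup_minus lookup_restrict_terms when_def)
      with pM show "\<exists>q. keys q \<subseteq> pp_multiples l E \<and> keys (p - q) \<subseteq> M"
        by (intro exI[of _ ?q]) (auto simp: keys_restrict_terms)
    qed
    finally show "J +>\<^bsub>B\<^esub> \<phi> p = \<zero>\<^bsub>graded_quot B J\<^esub> \<longleftrightarrow> keys p \<subseteq> M \<union> pp_multiples l E" .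
  qed
qed

theorem theorem4p6:
  fixes l :: nat and I :: "'k::field_char_0 polynomial set"
  assumes "1 \<le> l"
    and "almost_revlex_ideal l I"
  shows "has_k_slp (cring_class_ops :: 'k ring) l (graded_quot (poly_ring l) I)
           (\<lambda>i. I +>\<^bsub>poly_ring l\<^esub> var (l + 1 - i))"
proof -
  obtain G where G: "G \<subseteq> power_products l" and I: "I = Idl\<^bsub>poly_ring l\<^esub> (pp_poly ` G)"
    and revlex: "\<And>t t'. t \<in> G \<Longrightarrow> t' \<in> power_products l \<Longrightarrow> pp_deg t' = pp_deg t \<Longrightarrow>
      degrevlex_less t t' \<Longrightarrow> pp_poly t' \<in> I"
    using assms(2)
    by (auto simp: almost_revlex_ideal_def minimal_pp_generating_set_def pp_generating_set_def)
  let ?B = "graded_quot (poly_ring l) I"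
  let ?\<phi> = "\<lambda>p. I +>\<^bsub>poly_ring l\<^esub> p"
  \<comment> \<open>Exponents of the variables after \<open>x_j\<close>, which are the ones already
    factored out when \<open>x_j\<close> is the next Lefschetz element.\<close>
  let ?E = "\<lambda>j. (\<lambda>k. Poly_Mapping.single k (1::nat)) ` {j<..l}"
  interpret B: monomial_quotient l ?B ?\<phi> "pp_multiples l G"
    using G I by (rule monomial_quotient_of_poly_ring)
  \<comment> \<open>The almost revlex condition, moved from polynomials in \<open>I\<close> to
    exponents.\<close>
  have revlex': "w \<in> pp_multiples l G"
    if "g \<in> G" "w \<in> power_products l" "pp_deg w = pp_deg g" "degrevlex_less g w" for g w
    using revlex[OF that] unfolding I genideal_pp_poly[OF G] by simp
  note dichotomy = revlex_multiplication_dichotomy[OF G revlex']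
  have slp_1: "has_slp cring_class_ops ?B (?\<phi> (var (l + 1 - 1)))"
  proof -
    \<comment> \<open>At the first stage the set \<open>?E l\<close> is empty.\<close>
    have M: "pp_multiples l G = pp_multiples l (G \<union> ?E l)" by simp
    have j: "l \<in> {1..l}" using assms(1) by simp
    show ?thesis using B.variable_has_slp[OF j dichotomy[OF _ _ _ _ M j]] by simp
  qed
  have slp_i: "has_slp cring_class_ops (graded_quot ?B J) (J +>\<^bsub>?B\<^esub> ?\<phi> (var (l + 1 - i)))"
    if i: "i \<in> {2..l}" and J: "J = Idl\<^bsub>?B\<^esub> ((\<lambda>i. ?\<phi> (var (l + 1 - i))) ` {1..i - 1})" for i J
  proof -
    have j: "l + 1 - i \<in> {1..l}" using i by auto
    \<comment> \<open>The Lefschetz elements run backwards: the first \<open>i - 1\<close> are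
      \<open>x_l, ..., x_{l+2-i}\<close>, precisely the variables after \<open>x_{l+1-i}\<close>.
      The reversal is its own inverse on \<open>1, ..., l\<close>, which supplies the witness
      \<open>l + 1 - k\<close>.\<close>
    have "(\<lambda>i. l + 1 - i) ` {1..i - 1} = {l + 1 - i<..l}"
    proof (intro equalityI subsetI)
      fix k assume "k \<in> {l + 1 - i<..l}"
      then show "k \<in> (\<lambda>i. l + 1 - i) ` {1..i - 1}"
        using i by (intro image_eqI[of _ _ "l + 1 - k"]) auto
    qed (use i in auto)
    then have "?\<phi> ` pp_poly ` ?E (l + 1 - i) = (\<lambda>i. ?\<phi> (var (l + 1 - i))) ` {1..i - 1}"
      by (simp only: var_def image_image flip: \<open>_ = {l + 1 - i<..l}\<close>)
    with J have J': "J = Idl\<^bsub>?B\<^esub> (?\<phi> ` pp_poly ` ?E (l + 1 - i))" by simp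
    have E: "?E (l + 1 - i) \<subseteq> power_products l" by auto
    interpret Q: monomial_quotient l "graded_quot ?B J" "\<lambda>p. J +>\<^bsub>?B\<^esub> ?\<phi> p"
        "pp_multiples l G \<union> pp_multiples l (?E (l + 1 - i))"
      by (rule B.further_quotient[OF E J'])
    show ?thesis
      by (rule Q.variable_has_slp[OF j dichotomy[OF _ _ _ _ pp_multiples_Un[symmetric] j]])
  qed
  show ?thesis
    unfolding has_k_slp_def Let_def
  proof (intro conjI ballI)
    show "?\<phi> (var (l + 1 - i)) \<in> component ?B 1" if "i \<in> {1..l}" for i
      using that by (intro B.componentI) (auto simp: var_def)
    show "1 \<le> l" by (fact assms(1))
    show "has_slp cring_class_ops ?B (?\<phi> (var (l + 1 - 1)))" by (fact slp_1)
    show "has_slp cring_class_ops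
        (graded_quot ?B (Idl\<^bsub>?B\<^esub> ((\<lambda>i. ?\<phi> (var (l + 1 - i))) ` {1..i - 1})))
        (Idl\<^bsub>?B\<^esub> ((\<lambda>i. ?\<phi> (var (l + 1 - i))) ` {1..i - 1}) +>\<^bsub>?B\<^esub> ?\<phi> (var (l + 1 - i)))"
      if "i \<in> {2..l}" for i
      using that refl by (rule slp_i)
  qed
qed

end
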